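(* For every graph $G=(V,E)$ there are block configurations $\mathcal{B}^{\mathrm{M}(G)}$ and $\mathcal{B}^{\mathrm{PM}(G)}$ of size $|V|+2|E|$ and $2|E|$, respectively, such that $\mathrm{CTP}(\mathcal{B}^{\mathrm{M}(G)})$ and $\mathrm{CTP}(\mathcal{B}^{\mathrm{PM}(G)})$ are affinely isomorphic to the matching polytope and to the perfect matching polytope, respectively, of $G$.
   Context: Graphs are finite and undirected, without loops. The (perfect) matching polytope of $G$ is the convex hull in $\mathbb{R}^E$ of the incidence vectors of all (perfect) matchings of $G$. $\mathbb{F}_2$ is the field with two elements. A block configuration in $\mathbb{F}_2^d$ ($d\ge1$) is a sequence $\mathcal{B}=(\mathcal{B}(1),\dots,\mathcal{B}(n))$ with $n\ge2$ of non-empty subsets (blocks) $\mathcal{B}(i)\subseteq\mathbb{F}_2^d$; its size is $\sum_{i=1}^n|\mathcal{B}(i)|$. A cyclic transversal of $\mathcal{B}$ is a sequence $\xi=(\xi(1),\dots,\xi(n))$ with $\xi(i)\in\mathcal{B}(i)$ for all $i$ and $\sum_{i=1}^n\xi(i)=0$ in $\mathbb{F}_2^d$. Its incidence vector is $x=(x^1,\dots,x^n)$ with $x^i\in\{0,1\}^{\mathcal{B}(i)}$ and $x^i_\omega=1$ if and only if $\xi(i)=\omega$. The cyclic transversal polytope $\mathrm{CTP}(\mathcal{B})\subseteq\mathbb{R}^{\mathcal{B}(1)}\times\cdots\times\mathbb{R}^{\mathcal{B}(n)}$ is the convex hull of the incidence vectors of all cyclic transversals of $\mathcal{B}$ (possibly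 empty).
   Formalization: Graphs whose required size |V|+2|E| (for matchings) or 2|E| (for perfect matchings) is below 2 are excluded from the respective part, since a block configuration has at least two non-empty blocks and so size at least 2. *)

theory Defs
  imports "HOL-Analysis.Analysis" "HOL-Library.Z2" "HOL-Library.Function_Algebras"
begin

section \<open>Coordinate spaces\<close>

text \<open>
  A coordinate space \<open>K\<^sup>I\<close> whose index set \<open>I\<close> is a value and not a type is the set of all functions
  that vanish outside \<open>I\<close>, with the pointwise operations. The library has the additive
  structure on functions; the following instance adds the real scalar multiplication, so that
  \<open>linear\<close> and \<open>convex hull\<close> can be used.
\<close>

instantiation "fun" :: (type, real_vector) real_vector
begin

definition scaleR_fun :: "real \<Rightarrow> ('a \<Rightarrow> 'b) \<Rightarrow> 'a \<Rightarrow> 'b"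
  where "scaleR_fun r f = (\<lambda>x. r *\<^sub>R f x)"

instance
  by standard (simp_all add: scaleR_fun_def fun_eq_iff scaleR_add_right scaleR_add_left)

end

definition F2_space :: "nat \<Rightarrow> (nat \<Rightarrow> bit) set"
  where "F2_space d = {x. \<forall>k\<ge>d. x k = 0}"

text \<open>
  The affine map need only be bijective between the two sets, not on the ambient spaces. A map
  between coordinate spaces \<open>\<real>\<^sup>I\<close> and \<open>\<real>\<^sup>J\<close> extends to all functions by first
  restricting the argument to \<open>I\<close>, so it does not matter that \<open>L\<close> is defined on the whole type.
\<close>

definition affinely_isomorphic :: "'a::real_vector set \<Rightarrow> 'b::real_vector set \<Rightarrow> bool"
  where "affinely_isomorphic P Q \<longleftrightarrow>
    (\<exists>L c. linear L \<and> bij_betw (\<lambda>x. c + L x) P Q)"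


section \<open>Cyclic transversal polytopes\<close>

text \<open>A sequence \<open>(\<B>(1), \<dots>, \<B>(n))\<close> is a list, hence indexed from \<open>0\<close> to \<open>n - 1\<close>.\<close>

definition block_configuration :: "nat \<Rightarrow> (nat \<Rightarrow> bit) set list \<Rightarrow> bool"
  where "block_configuration d \<B> \<longleftrightarrow>
    1 \<le> d \<and> 2 \<le> length \<B> \<and> (\<forall>i<length \<B>. \<B> ! i \<noteq> {} \<and> \<B> ! i \<subseteq> F2_space d)"

definition config_size :: "(nat \<Rightarrow> bit) set list \<Rightarrow> nat"
  where "config_size \<B> = (\<Sum>i<length \<B>. card (\<B> ! i))"

definition cyclic_transversals :: "(nat \<Rightarrow> bit) set list \<Rightarrow> (nat \<Rightarrow> bit) list set"
  where "cyclic_transversals \<B> =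
    {\<xi>. length \<xi> = length \<B> \<and> (\<forall>i<length \<B>. \<xi> ! i \<in> \<B> ! i) \<and> (\<Sum>i<length \<B>. \<xi> ! i) = 0}"

text \<open>
  The product of the spaces \<open>\<real>\<^bsup>\<B>(i)\<^esup>\<close> is the coordinate space indexed by the pairs \<open>(i, \<omega>)\<close>
  with \<open>\<omega> \<in> \<B>(i)\<close>.
\<close>

definition transversal_incidence :: "(nat \<Rightarrow> bit) list \<Rightarrow> nat \<times> (nat \<Rightarrow> bit) \<Rightarrow> real"
  where "transversal_incidence \<xi> = (\<lambda>(i, \<omega>). if i < length \<xi> \<and> \<xi> ! i = \<omega> then 1 else 0)"

definition CTP :: "(nat \<Rightarrow> bit) set list \<Rightarrow> (nat \<times> (nat \<Rightarrow> bit) \<Rightarrow> real) set"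
  where "CTP \<B> = convex hull (transversal_incidence ` cyclic_transversals \<B>)"

lemma finite_F2_space: "finite (F2_space d)"
proof (rule finite_subset)
  show "F2_space d \<subseteq> (\<lambda>S k. if k \<in> S then 1 else 0) ` Pow {..<d}"
  proof
    fix x assume x: "x \<in> F2_space d"
    have "x k = (if k \<in> {k. x k = 1} then 1 else 0)" for k
      by (cases "x k = 1") simp_all
    then have eq: "x = (\<lambda>k. if k \<in> {k. x k = 1} then 1 else 0)"
      by (rule ext)
    have "k < d" if "x k = 1" for k
      using x that by (cases "k < d") (simp_all add: F2_space_def)
    then have "{k. x k = 1} \<in> Pow {..<d}"
      by blast
    with eq show "x \<in> (\<lambda>S k. if k \<in> S then 1 else 0) ` Pow {..<d}"
      by (rule image_eqI)
  qed
qed simp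

text \<open>
  Since a block configuration has at least two non-empty blocks, none has size \<open>0\<close> or \<open>1\<close>. Statements that
  prescribe a size in terms of a graph have to exclude the graphs for which it would be that small.
\<close>

lemma config_size_ge_2:
  assumes "block_configuration d \<B>"
  shows "2 \<le> config_size \<B>"
proof -
  have "1 \<le> card (\<B> ! i)" if "i < length \<B>" for i
  proof -
    have "\<B> ! i \<noteq> {}" and "\<B> ! i \<subseteq> F2_space d"
      using assms that by (simp_all add: block_configuration_def)
    then have "card (\<B> ! i) \<noteq> 0"
      using finite_subset [OF _ finite_F2_space] by (metis card_eq_0_iff)
    then show ?thesis
      by linarith
  qed
  then have "(\<Sum>i<length \<B>. 1) \<le> (\<Sum>i<length \<B>. card (\<B> ! i))"
    by (intro sum_mono) simp
  moreover have "2 \<le> length \<B>"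
    using assms by (simp add: block_configuration_def)
  ultimately show ?thesis
    unfolding config_size_def by simp
qed


section \<open>Graphs and matching polytopes\<close>

text \<open>
  Edges have an identity of their own and \<open>ends e\<close> is the set of end nodes of \<open>e\<close>, so parallel
  edges are allowed. Simple graphs are the case where \<open>ends\<close> is the identity.
\<close>

definition loopless_graph :: "'v set \<Rightarrow> 'e set \<Rightarrow> ('e \<Rightarrow> 'v set) \<Rightarrow> bool"
  where "loopless_graph V E ends \<longleftrightarrow>
    finite V \<and> finite E \<and> (\<forall>e\<in>E. ends e \<subseteq> V \<and> card (ends e) = 2)"

definition matchings :: "'e set \<Rightarrow> ('e \<Rightarrow> 'v set) \<Rightarrow> 'e set set"
  where "matchings E ends = {M. M \<subseteq> E \<and> disjoint_family_on ends M}"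

definition perfect_matchings :: "'v set \<Rightarrow> 'e set \<Rightarrow> ('e \<Rightarrow> 'v set) \<Rightarrow> 'e set set"
  where "perfect_matchings V E ends = {M \<in> matchings E ends. (\<Union>e\<in>M. ends e) = V}"

definition matching_polytope :: "'e set \<Rightarrow> ('e \<Rightarrow> 'v set) \<Rightarrow> ('e \<Rightarrow> real) set"
  where "matching_polytope E ends = convex hull (indicat_real ` matchings E ends)"

definition perfect_matching_polytope :: "'v set \<Rightarrow> 'e set \<Rightarrow> ('e \<Rightarrow> 'v set) \<Rightarrow> ('e \<Rightarrow> real) set"
  where "perfect_matching_polytope V E ends = convex hull (indicat_real ` perfect_matchings V E ends)"

end

theory Submission
  imports Defs
begin

text \<open>
  Let every vertex \<open>v\<close> have a block that contains the unit vectors \<open>unit e\<close> of \<open>\<bbbF>\<^sub>2\<^sup>E\<close> for the edges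
  \<open>e\<close> at \<open>v\<close>, and, for matchings that need not be perfect, also the zero vector. Choosing one
  element from every block means that every vertex picks at most one of its edges, or exactly one
  if zero is absent. The unit vector of \<open>e\<close> occurs only in the blocks of the two ends of \<open>e\<close>, so
  over the field with two elements the choices sum to zero if and only if the two ends of every edge
  agree on whether to pick it. Hence the cyclic transversals are the (perfect) matchings
  (\<open>image_chosen_edges\<close>). Every edge counts in two blocks, which gives the size \<open>2|E|\<close>, plus \<open>|V|\<close>
  for the zeros (\<open>config_size_blocks\<close>).

  Under this correspondence the coordinates of a transversal and of its matching determine each
  other affinely: \<open>x\<^sup>v\<^sub>e = y\<^sub>e\<close> for every end \<open>v\<close> of \<open>e\<close>, and
  \<open>x\<^sup>v\<^sub>0 = 1 - \<Sum>\<^sub>e y\<^sub>e\<close> with the sum over the edges at \<open>v\<close>. Equations of this kind that hold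
  at the vertices hold on the convex hulls, so the polytopes are affinely isomorphic
  (\<open>affinely_isomorphic_convex_hull\<close>, \<open>CTP_affinely_isomorphic\<close>).

  The construction without zeros breaks down if there is an isolated vertex, because its block
  would be empty. Then there is no perfect matching, and any block configuration of the right size
  without a cyclic transversal will do (\<open>ex_block_configuration_no_transversal\<close>).
\<close>

section \<open>Affine isomorphisms of convex hulls\<close>

lemma linear_fun_apply:
  assumes "\<And>j. linear (\<lambda>x. F x j)"
  shows "linear F"
  using assms by (auto simp: linear_iff fun_eq_iff scaleR_fun_def)

text \<open>
  It suffices to have the inverse on the generators: the points that an affine map fixes form a
  convex set, so \<open>y \<mapsto> c + G y\<close> undoes \<open>L\<close> on the whole convex hull of \<open>A\<close>.
\<close>

lemma affinely_isomorphic_convex_hull: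
  assumes L: "linear L" and G: "linear G"
    and surj: "L ` A = B" and inverse: "\<And>x. x \<in> A \<Longrightarrow> c + G (L x) = x"
  shows "affinely_isomorphic (convex hull A) (convex hull B)"
proof -
  have fixed: "c + G (L x) = x" if "x \<in> convex hull A" for x
  proof -
    have "convex {x. c + G (L x) = x}"
    proof (rule convexI)
      fix x y and s t :: real
      assume x: "x \<in> {x. c + G (L x) = x}" and y: "y \<in> {x. c + G (L x) = x}" and st: "s + t = 1"
      have "c + G (L (s *\<^sub>R x + t *\<^sub>R y)) = (s + t) *\<^sub>R c + (s *\<^sub>R G (L x) + t *\<^sub>R G (L y))"
        using st by (simp add: linear_add linear_scale L G)
      also have "\<dots> = s *\<^sub>R (c + G (L x)) + t *\<^sub>R (c + G (L y))"
        by (simp add: algebra_simps)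
      finally show "s *\<^sub>R x + t *\<^sub>R y \<in> {x. c + G (L x) = x}"
        using x y by simp
    qed
    then have "convex hull A \<subseteq> {x. c + G (L x) = x}"
      using inverse by (intro hull_minimal) auto
    with that show ?thesis
      by blast
  qed
  have "inj_on L (convex hull A)"
    by (rule inj_on_inverseI [where g = "\<lambda>y. c + G y"]) (rule fixed)
  moreover have "L ` (convex hull A) = convex hull B"
    using convex_hull_linear_image [OF L, of A] surj by simp
  ultimately have "bij_betw (\<lambda>x. 0 + L x) (convex hull A) (convex hull B)"
    by (simp add: bij_betw_def)
  then show ?thesis
    using L unfolding affinely_isomorphic_def by blast
qed


section \<open>Matchings as cyclic transversals\<close>

lemma sum_fun_apply: "(\<Sum>i\<in>A. f i) x = (\<Sum>i\<in>A. f i x)"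
  for f :: "'i \<Rightarrow> 'a \<Rightarrow> 'b::comm_monoid_add"
  by (induction A rule: infinite_finite_induct) simp_all

text \<open>
  Block configurations are sequences of sets of vectors indexed by natural numbers. The list \<open>vs\<close>
  puts the vertices into positions, so that block \<open>i\<close> belongs to the vertex \<open>vs ! i\<close>, and \<open>idx\<close>
  assigns a coordinate to every edge.
\<close>

locale enumerated_graph =
  fixes E :: "'e set" and ends :: "'e \<Rightarrow> 'v set" and vs :: "'v list" and idx :: "'e \<Rightarrow> nat"
  assumes graph: "loopless_graph (set vs) E ends"
    and distinct: "distinct vs" and inj_idx: "inj_on idx E"
begin

definition unit :: "'e \<Rightarrow> nat \<Rightarrow> bit"
  where "unit e = (\<lambda>k. of_bool (k = idx e))"

definition star :: "nat \<Rightarrow> 'e set"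
  where "star i = {e \<in> E. vs ! i \<in> ends e}"

definition end_positions :: "'e \<Rightarrow> nat set"
  where "end_positions e = {i. i < length vs \<and> vs ! i \<in> ends e}"

text \<open>
  The set \<open>Z\<close> is \<open>{0}\<close> for matchings and \<open>{}\<close> for perfect matchings; the zero vector stands for
  leaving the vertex uncovered.
\<close>

definition blocks :: "(nat \<Rightarrow> bit) set \<Rightarrow> (nat \<Rightarrow> bit) set list"
  where "blocks Z = map (\<lambda>i. unit ` star i \<union> Z) [0..<length vs]"

lemma length_blocks [simp]: "length (blocks Z) = length vs"
  by (simp add: blocks_def)

lemma nth_blocks [simp]: "i < length vs \<Longrightarrow> blocks Z ! i = unit ` star i \<union> Z"
  by (simp add: blocks_def)

lemma finite_E: "finite E"
  using graph by (simp add: loopless_graph_def)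

lemma finite_star [simp]: "finite (star i)"
  using finite_E by (simp add: star_def)

lemma star_subset: "star i \<subseteq> E"
  by (auto simp: star_def)

lemma unit_at_idx: "e \<in> E \<Longrightarrow> f \<in> E \<Longrightarrow> unit f (idx e) = of_bool (f = e)"
  using inj_idx by (auto simp: unit_def inj_on_def)

lemma unit_eq_iff: "e \<in> E \<Longrightarrow> f \<in> E \<Longrightarrow> unit f = unit e \<longleftrightarrow> f = e"
  by (auto simp: unit_at_idx dest!: fun_cong [where x = "idx e"])

lemma unit_nonzero: "unit e \<noteq> 0"
  by (auto simp: unit_def fun_eq_iff)

lemma unit_double: "unit e + unit e = 0"
  by (simp add: unit_def fun_eq_iff)

lemma inj_on_unit: "inj_on unit E"
  by (auto simp: inj_on_def unit_eq_iff)

lemma card_end_positions: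
  assumes "e \<in> E"
  shows "card (end_positions e) = 2"
proof -
  have "bij_betw ((!) vs) (end_positions e) (ends e)"
    unfolding bij_betw_def
  proof
    show "inj_on ((!) vs) (end_positions e)"
      using distinct by (auto simp: inj_on_def end_positions_def nth_eq_iff_index_eq)
    show "(!) vs ` end_positions e = ends e"
      using graph assms
      by (auto simp: end_positions_def loopless_graph_def image_iff) (metis in_set_conv_nth subsetD)
  qed
  then show ?thesis
    using graph assms by (simp add: bij_betw_same_card loopless_graph_def)
qed

text \<open>
  An arbitrary end of each edge. In a cyclic transversal both ends agree on whether to pick the
  edge, so reading off the choice at one of them is enough.
\<close>

definition end_position :: "'e \<Rightarrow> nat"
  where "end_position e = (SOME i. i \<in> end_positions e)"

lemma end_position_in: "e \<in> E \<Longrightarrow> end_position e \<in> end_positions e"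
  unfolding end_position_def by (rule someI_ex) (use card_end_positions [of e] in \<open>force simp: card_2_iff\<close>)

text \<open>Double counting of the incidences between vertices and edges.\<close>

lemma config_size_blocks:
  assumes "Z \<subseteq> {0}"
  shows "config_size (blocks Z) = 2 * card E + length vs * card Z"
proof -
  have "card (blocks Z ! i) = card (star i) + card Z" if "i < length vs" for i
  proof -
    have "unit ` star i \<inter> Z = {}"
      using assms unit_nonzero by fastforce
    moreover have "card (unit ` star i) = card (star i)"
      by (rule card_image) (rule inj_on_subset [OF inj_on_unit star_subset])
    ultimately show ?thesis
      using that finite_subset [OF assms] by (simp add: card_Un_disjoint)
  qed
  moreover have "(\<Sum>i<length vs. card (star i)) = card E * 2"
  proof -
    have "(\<Sum>i\<in>{..<length vs}. card {e \<in> E. vs ! i \<in> ends e}) = 2 * card E"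
    proof (rule sum_multicount)
      show "\<forall>e\<in>E. card {i \<in> {..<length vs}. vs ! i \<in> ends e} = 2"
        using card_end_positions by (simp add: end_positions_def)
    qed (use finite_E in auto)
    then show ?thesis
      by (simp add: star_def)
  qed
  ultimately show ?thesis
    by (simp add: config_size_def sum.distrib)
qed

lemma block_configuration_blocks:
  assumes "idx ` E \<subseteq> {..<d}" and "1 \<le> d" and "2 \<le> length vs" and "Z \<subseteq> {0}"
    and nonempty: "\<And>i. i < length vs \<Longrightarrow> star i \<noteq> {} \<or> Z \<noteq> {}"
  shows "block_configuration d (blocks Z)"
proof -
  have "unit e \<in> F2_space d" if "e \<in> E" for e
    using assms(1) that by (auto simp: F2_space_def unit_def)
  moreover have "0 \<in> F2_space d"
    by (simp add: F2_space_def)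
  ultimately have "unit ` star i \<union> Z \<subseteq> F2_space d" for i
    using \<open>Z \<subseteq> {0}\<close> star_subset [of i] by (auto simp: subset_iff)
  then show ?thesis
    using assms(2,3) nonempty by (simp add: block_configuration_def)
qed

definition chosen_edges :: "(nat \<Rightarrow> bit) list \<Rightarrow> 'e set"
  where "chosen_edges \<xi> = {e \<in> E. \<xi> ! end_position e = unit e}"

text \<open>
  For a matching \<open>M\<close> the inner sum has at most one term, the edge that covers the vertex. Writing
  the choice as a sum gives zero for an uncovered vertex and lets the total be computed by exchanging
  the order of summation.
\<close>

definition matching_transversal :: "'e set \<Rightarrow> (nat \<Rightarrow> bit) list"
  where "matching_transversal M =
    map (\<lambda>i. \<Sum>e\<in>{e \<in> M. vs ! i \<in> ends e}. unit e) [0..<length vs]"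

definition admissible :: "(nat \<Rightarrow> bit) set \<Rightarrow> 'e set set"
  where "admissible Z = {M \<in> matchings E ends. Z = {} \<longrightarrow> (\<Union>e\<in>M. ends e) = set vs}"

context
  fixes Z :: "(nat \<Rightarrow> bit) set"
  assumes Z: "Z \<subseteq> {0}"
begin

lemma transversal_nth_cases:
  assumes "\<xi> \<in> cyclic_transversals (blocks Z)" and "i < length vs"
  obtains e where "e \<in> star i" "\<xi> ! i = unit e" | "\<xi> ! i = 0" "Z \<noteq> {}"
proof -
  have "\<xi> ! i \<in> unit ` star i \<union> Z"
    using assms by (auto simp: cyclic_transversals_def)
  then show thesis
    using Z that by (metis UnE empty_iff imageE singletonD subsetD)
qed

text \<open>
  The heart of the construction: in the coordinate of \<open>e\<close> only the two ends of \<open>e\<close> can contribute to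
  the sum, which is zero modulo \<open>2\<close>, so either both ends pick \<open>e\<close> or neither does.
\<close>

lemma transversal_consistent:
  assumes \<xi>: "\<xi> \<in> cyclic_transversals (blocks Z)" and e: "e \<in> E"
    and ij: "i \<in> end_positions e" "j \<in> end_positions e" and i: "\<xi> ! i = unit e"
  shows "\<xi> ! j = unit e"
proof (cases "i = j")
  case False
  have pos: "end_positions e = {i, j}"
  proof (rule sym, rule card_subset_eq)
    show "finite (end_positions e)"
      by (simp add: end_positions_def)
  qed (use False ij card_end_positions [OF e] in auto)
  have unit_iff: "(\<xi> ! k) (idx e) = of_bool (\<xi> ! k = unit e)" if k: "k < length vs" for k
    using \<xi> k
  proof (cases rule: transversal_nth_cases)
    case (1 f)
    then have "f \<in> E"
      using star_subset by blast
    then show ?thesis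
      using 1 e by (simp add: unit_at_idx unit_eq_iff)
  next
    case 2
    then show ?thesis
      using unit_nonzero [of e] by (auto simp: unit_nonzero [symmetric])
  qed
  have outside: "\<xi> ! k \<noteq> unit e" if k: "k < length vs" "k \<notin> {i, j}" for k
    using \<xi> k(1)
  proof (cases rule: transversal_nth_cases)
    case (1 f)
    have "f \<noteq> e"
      using 1 k pos by (auto simp: star_def end_positions_def)
    then show ?thesis
      using 1 e star_subset unit_eq_iff by auto
  next
    case 2
    then show ?thesis
      using unit_nonzero [of e] by simp
  qed
  have "(\<Sum>k<length vs. \<xi> ! k) = 0"
    using \<xi> by (simp add: cyclic_transversals_def)
  then have "(\<Sum>k<length vs. (\<xi> ! k) (idx e)) = 0"
    by (simp flip: sum_fun_apply)
  also have "(\<Sum>k<length vs. (\<xi> ! k) (idx e)) = (\<Sum>k\<in>{i, j}. (\<xi> ! k) (idx e))"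
  proof (rule sum.mono_neutral_right)
    show "{i, j} \<subseteq> {..<length vs}"
      using ij by (auto simp: end_positions_def)
  qed (use unit_iff outside in auto)
  finally have "of_bool (\<xi> ! i = unit e) + of_bool (\<xi> ! j = unit e) = (0::bit)"
    using False ij unit_iff by (simp add: end_positions_def)
  then show ?thesis
    using i by (cases "\<xi> ! j = unit e") simp_all
qed (use i in simp)

lemma transversal_nth_iff:
  assumes "\<xi> \<in> cyclic_transversals (blocks Z)" and "i < length vs" and "e \<in> star i"
  shows "\<xi> ! i = unit e \<longleftrightarrow> e \<in> chosen_edges \<xi>"
proof -
  have e: "e \<in> E" and i: "i \<in> end_positions e"
    using assms by (auto simp: star_def end_positions_def)
  show ?thesis
    using transversal_consistent [OF assms(1) e i end_position_in [OF e]]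
      transversal_consistent [OF assms(1) e end_position_in [OF e] i] e
    by (simp add: chosen_edges_def iffI)
qed

text \<open>
  Two chosen edges with a common vertex would both have to be its single choice. Without zeros in
  the blocks every vertex has to pick an edge, and so it is covered.
\<close>

lemma chosen_edges_admissible:
  assumes \<xi>: "\<xi> \<in> cyclic_transversals (blocks Z)"
  shows "chosen_edges \<xi> \<in> admissible Z"
proof -
  have sub: "chosen_edges \<xi> \<subseteq> E"
    by (auto simp: chosen_edges_def)
  have ends: "ends e \<subseteq> set vs" if "e \<in> E" for e
    using graph that by (simp add: loopless_graph_def)
  have "e = f" if "e \<in> chosen_edges \<xi>" "f \<in> chosen_edges \<xi>" "v \<in> ends e" "v \<in> ends f" for e f v
  proof -
    have "v \<in> set vs"
      using that(1,3) ends sub by blast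
    then obtain i where i: "i < length vs" "vs ! i = v"
      by (auto simp: in_set_conv_nth)
    have "e \<in> star i" "f \<in> star i"
      using that sub i(2) by (auto simp: star_def)
    then have "\<xi> ! i = unit e" "\<xi> ! i = unit f"
      using transversal_nth_iff [OF \<xi> i(1)] that by simp_all
    then show "e = f"
      using that(1,2) sub unit_eq_iff [of f e] by auto
  qed
  then have "chosen_edges \<xi> \<in> matchings E ends"
    using sub by (auto simp: matchings_def disjoint_family_on_def)
  moreover have "set vs \<subseteq> (\<Union>e\<in>chosen_edges \<xi>. ends e)" if "Z = {}"
  proof
    fix v assume "v \<in> set vs"
    then obtain i where i: "i < length vs" "vs ! i = v"
      by (auto simp: in_set_conv_nth)
    from \<xi> i(1) show "v \<in> (\<Union>e\<in>chosen_edges \<xi>. ends e)"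
    proof (cases rule: transversal_nth_cases)
      case (1 e)
      then show ?thesis
        using transversal_nth_iff [OF \<xi> i(1)] i(2) by (auto simp: star_def)
    qed (use that in simp)
  qed
  ultimately show ?thesis
    using sub ends by (auto simp: admissible_def)
qed

lemma matching_transversal_nth:
  assumes M: "M \<in> admissible Z" and i: "i < length vs"
  shows "e \<in> M \<Longrightarrow> vs ! i \<in> ends e \<Longrightarrow> matching_transversal M ! i = unit e"
    and "(\<And>e. e \<in> M \<Longrightarrow> vs ! i \<notin> ends e) \<Longrightarrow> matching_transversal M ! i = 0"
proof -
  assume e: "e \<in> M" "vs ! i \<in> ends e"
  then have "{e \<in> M. vs ! i \<in> ends e} = {e}"
    using M by (fastforce simp: admissible_def matchings_def disjoint_family_on_def)
  then show "matching_transversal M ! i = unit e"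
    using i by (simp add: matching_transversal_def)
next
  assume "\<And>e. e \<in> M \<Longrightarrow> vs ! i \<notin> ends e"
  then have "{e \<in> M. vs ! i \<in> ends e} = {}"
    by blast
  moreover have "matching_transversal M ! i = (\<Sum>e\<in>{e \<in> M. vs ! i \<in> ends e}. unit e)"
    using i by (simp add: matching_transversal_def)
  ultimately show "matching_transversal M ! i = 0"
    by (simp only: sum.empty)
qed

text \<open>The unit vector of every edge in \<open>M\<close> is picked at both ends and therefore cancels.\<close>

lemma matching_transversal_cyclic:
  assumes M: "M \<in> admissible Z"
  shows "matching_transversal M \<in> cyclic_transversals (blocks Z)"
proof -
  have sub: "M \<subseteq> E"
    using M by (simp add: admissible_def matchings_def)
  have "matching_transversal M ! i \<in> unit ` star i \<union> Z" if i: "i < length vs" for i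
  proof (cases "\<exists>e\<in>M. vs ! i \<in> ends e")
    case True
    then obtain e where e: "e \<in> M" "vs ! i \<in> ends e"
      by blast
    then show ?thesis
      using matching_transversal_nth(1) [OF M i e] sub by (auto simp: star_def)
  next
    case False
    then have "vs ! i \<notin> (\<Union>e\<in>M. ends e)"
      by blast
    then have "Z \<noteq> {}"
      using M i by (auto simp: admissible_def)
    then show ?thesis
      using matching_transversal_nth(2) [OF M i] False Z by auto
  qed
  moreover have "(\<Sum>i<length vs. matching_transversal M ! i) = 0"
  proof -
    have "(\<Sum>i<length vs. matching_transversal M ! i) =
        (\<Sum>i\<in>{..<length vs}. \<Sum>e\<in>{e \<in> M. vs ! i \<in> ends e}. unit e)"
      by (simp add: matching_transversal_def)
    also have "\<dots> = (\<Sum>e\<in>M. \<Sum>i\<in>{i \<in> {..<length vs}. vs ! i \<in> ends e}. unit e)"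
      using finite_subset [OF sub finite_E] by (intro sum.swap_restrict) auto
    also have "\<dots> = (\<Sum>e\<in>M. 0)"
    proof (rule sum.cong)
      fix e assume "e \<in> M"
      then obtain i j where "i \<noteq> j" "{i \<in> {..<length vs}. vs ! i \<in> ends e} = {i, j}"
        using card_end_positions [of e] sub by (auto simp: end_positions_def card_2_iff)
      then show "(\<Sum>i\<in>{i \<in> {..<length vs}. vs ! i \<in> ends e}. unit e) = 0"
        by (simp add: unit_double del: sum_constant)
    qed simp
    finally show ?thesis
      by simp
  qed
  ultimately show ?thesis
    by (simp add: cyclic_transversals_def) (simp add: matching_transversal_def)
qed

lemma chosen_edges_matching_transversal:
  assumes M: "M \<in> admissible Z"
  shows "chosen_edges (matching_transversal M) = M"
proof -
  have sub: "M \<subseteq> E"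
    using M by (simp add: admissible_def matchings_def)
  have "matching_transversal M ! end_position e = unit e \<longleftrightarrow> e \<in> M" if e: "e \<in> E" for e
  proof -
    have i: "end_position e < length vs" "vs ! end_position e \<in> ends e"
      using end_position_in [OF e] by (auto simp: end_positions_def)
    show ?thesis
    proof
      assume eq: "matching_transversal M ! end_position e = unit e"
      then obtain f where f: "f \<in> M" "vs ! end_position e \<in> ends f"
        using matching_transversal_nth(2) [OF M i(1)] unit_nonzero by metis
      then have "unit f = unit e"
        using eq matching_transversal_nth(1) [OF M i(1) f] by simp
      then show "e \<in> M"
        using f e sub unit_eq_iff by blast
    qed (use matching_transversal_nth(1) [OF M i(1)] i in blast)
  qed
  then show ?thesis
    using sub by (auto simp: chosen_edges_def)
qed

lemma image_chosen_edges: "chosen_edges ` cyclic_transversals (blocks Z) = admissible Z"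
proof
  show "chosen_edges ` cyclic_transversals (blocks Z) \<subseteq> admissible Z"
    using chosen_edges_admissible by blast
  show "admissible Z \<subseteq> chosen_edges ` cyclic_transversals (blocks Z)"
  proof
    fix M assume M: "M \<in> admissible Z"
    show "M \<in> chosen_edges ` cyclic_transversals (blocks Z)"
      by (rule image_eqI [where x = "matching_transversal M"])
        (simp_all add: M chosen_edges_matching_transversal matching_transversal_cyclic)
  qed
qed

text \<open>
  \<open>L\<close> reads off \<open>y\<^sub>e\<close> at one end of \<open>e\<close>; \<open>y \<mapsto> c + G y\<close> reconstructs the transversal. It treats both
  kinds of blocks alike: the coordinate \<open>(i, 0)\<close> receives \<open>1 - \<Sum>\<^sub>e y\<^sub>e\<close> over the edges at vertex \<open>i\<close>, and
  this is \<open>0\<close> whenever the vertex is covered.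
\<close>

lemma CTP_affinely_isomorphic:
  "affinely_isomorphic (CTP (blocks Z)) (convex hull (indicat_real ` admissible Z))"
proof -
  let ?n = "length vs"
  define L :: "(nat \<times> (nat \<Rightarrow> bit) \<Rightarrow> real) \<Rightarrow> 'e \<Rightarrow> real"
    where "L = (\<lambda>x e. of_bool (e \<in> E) * x (end_position e, unit e))"
  define G :: "('e \<Rightarrow> real) \<Rightarrow> nat \<times> (nat \<Rightarrow> bit) \<Rightarrow> real"
    where "G = (\<lambda>y p. \<Sum>e\<in>star (fst p).
      of_bool (fst p < ?n) * (of_bool (snd p = unit e) - of_bool (snd p = 0)) * y e)"
  define c :: "nat \<times> (nat \<Rightarrow> bit) \<Rightarrow> real"
    where "c = (\<lambda>p. of_bool (fst p < ?n \<and> snd p = 0))"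
  have linear_L: "linear L"
    by (rule linear_fun_apply)
      (auto simp: L_def linear_iff scaleR_fun_def algebra_simps)
  have linear_G: "linear G"
    by (rule linear_fun_apply)
      (auto simp: G_def linear_iff scaleR_fun_def algebra_simps sum.distrib sum_distrib_left
         sum_subtractf)
  have L_incidence: "L (transversal_incidence \<xi>) = indicat_real (chosen_edges \<xi>)"
    if "\<xi> \<in> cyclic_transversals (blocks Z)" for \<xi>
  proof
    fix e
    have "length \<xi> = ?n"
      using that by (simp add: cyclic_transversals_def)
    then show "L (transversal_incidence \<xi>) e = indicat_real (chosen_edges \<xi>) e"
      using end_position_in [of e]
      by (auto simp: L_def transversal_incidence_def chosen_edges_def end_positions_def indicator_def)
  qed
  have inverse: "c + G (L (transversal_incidence \<xi>)) = transversal_incidence \<xi>"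
    if \<xi>: "\<xi> \<in> cyclic_transversals (blocks Z)" for \<xi>
  proof
    fix p :: "nat \<times> (nat \<Rightarrow> bit)"
    obtain i \<omega> where p: "p = (i, \<omega>)"
      by (cases p)
    have len: "length \<xi> = ?n"
      using \<xi> by (simp add: cyclic_transversals_def)
    show "(c + G (L (transversal_incidence \<xi>))) p = transversal_incidence \<xi> p"
    proof (cases "i < ?n")
      case i: True
      have "G (L (transversal_incidence \<xi>)) p =
          (\<Sum>e\<in>star i. (of_bool (\<omega> = unit e) - of_bool (\<omega> = 0)) * of_bool (\<xi> ! i = unit e))"
        unfolding L_incidence [OF \<xi>] G_def
        using transversal_nth_iff [OF \<xi> i] i by (intro sum.cong) (auto simp: p indicator_def)
      also have "\<dots> = of_bool (\<omega> = \<xi> ! i) - of_bool (\<omega> = 0)"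
        using \<xi> i
      proof (cases rule: transversal_nth_cases)
        case (1 f)
        have "(\<Sum>e\<in>star i. (of_bool (\<omega> = unit e) - of_bool (\<omega> = 0)) * of_bool (\<xi> ! i = unit e)) =
            (\<Sum>e\<in>{f}. (of_bool (\<omega> = unit e) - of_bool (\<omega> = 0)) * of_bool (\<xi> ! i = unit e) :: real)"
          using 1 star_subset [of i] by (intro sum.mono_neutral_right) (auto simp: unit_eq_iff subset_iff)
        then show ?thesis
          using 1 by simp
      next
        case 2
        then show ?thesis
          using unit_nonzero by (simp add: unit_nonzero [symmetric])
      qed
      finally show ?thesis
        using i len by (auto simp: p c_def transversal_incidence_def)
    qed (use len in \<open>simp add: p c_def G_def transversal_incidence_def\<close>)
  qed
  have "L ` (transversal_incidence ` cyclic_transversals (blocks Z)) =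
      (\<lambda>\<xi>. indicat_real (chosen_edges \<xi>)) ` cyclic_transversals (blocks Z)"
    using L_incidence by (auto simp: image_image)
  also have "\<dots> = indicat_real ` admissible Z"
    by (simp only: image_chosen_edges [symmetric] image_image)
  finally show ?thesis
    unfolding CTP_def
    by (rule affinely_isomorphic_convex_hull [OF linear_L linear_G, where c = c]) (auto simp: inverse)
qed

end

lemma two_le_length:
  assumes "E \<noteq> {}"
  shows "2 \<le> length vs"
proof -
  obtain e where "e \<in> E"
    using assms by blast
  then have "ends e \<subseteq> set vs" "card (ends e) = 2"
    using graph by (auto simp: loopless_graph_def)
  then show ?thesis
    using card_mono [of "set vs" "ends e"] card_length [of vs] by simp
qed

end


section \<open>Empty transversal polytopes\<close>

text \<open>
  With two blocks of which one is \<open>{0}\<close> and the other consists of nonzero vectors, no transversal has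
  sum zero; the size of the second block is free.
\<close>

lemma ex_block_configuration_no_transversal:
  assumes "2 \<le> s"
  shows "\<exists>d \<B>. block_configuration d \<B> \<and> config_size \<B> = s \<and> cyclic_transversals \<B> = {}"
proof -
  define u :: "nat \<Rightarrow> nat \<Rightarrow> bit" where "u m = (\<lambda>k. of_bool (k = m))" for m
  have "inj_on u {..<s - 1}"
    by (auto simp: inj_on_def u_def fun_eq_iff)
  then have card: "card (u ` {..<s - 1}) = s - 1"
    by (simp add: card_image)
  let ?B = "[{0}, u ` {..<s - 1}]"
  have nonzero: "u m \<noteq> 0" for m
    by (auto simp: u_def fun_eq_iff)
  have "block_configuration s ?B"
    using assms by (auto simp: block_configuration_def less_Suc_eq F2_space_def u_def lessThan_empty_iff)
  moreover have "config_size ?B = s"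
    using assms card by (simp add: config_size_def)
  moreover have "cyclic_transversals ?B = {}"
  proof (rule equals0I)
    fix \<xi> assume \<xi>: "\<xi> \<in> cyclic_transversals ?B"
    then have mem: "\<xi> ! i \<in> ?B ! i" if "i < 2" for i
      using that by (simp add: cyclic_transversals_def)
    have "\<xi> ! 0 + \<xi> ! 1 = 0"
      using \<xi> by (simp add: cyclic_transversals_def)
    then show False
      using mem [of 0] mem [of 1] nonzero by auto
  qed
  ultimately show ?thesis
    by blast
qed


section \<open>Matching polytopes as cyclic transversal polytopes\<close>

theorem corollary3p10:
  fixes V :: "'v set" and E :: "'e set" and ends :: "'e \<Rightarrow> 'v set"
  assumes "loopless_graph V E ends"
  shows "(2 \<le> card V + 2 * card E \<longrightarrow>
           (\<exists>d \<B>. block_configuration d \<B> \<and> config_size \<B> = card V + 2 * card E \<and>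
                  affinely_isomorphic (CTP \<B>) (matching_polytope E ends))) \<and>
         (2 \<le> 2 * card E \<longrightarrow>
           (\<exists>d \<B>. block_configuration d \<B> \<and> config_size \<B> = 2 * card E \<and>
                  affinely_isomorphic (CTP \<B>) (perfect_matching_polytope V E ends)))"
proof -
  have fin: "finite V" "finite E"
    using assms by (simp_all add: loopless_graph_def)
  obtain vs where vs: "set vs = V" "distinct vs"
    using finite_distinct_list [OF fin(1)] by blast
  obtain idx :: "'e \<Rightarrow> nat" and n where idx: "idx ` E = {i. i < n}" "inj_on idx E"
    using finite_imp_inj_to_nat_seg [OF fin(2)] by blast
  interpret enumerated_graph E ends vs idx
    using assms vs idx by unfold_locales simp_all
  have len: "length vs = card V"
    using vs distinct_card by metis
  have idx_less: "idx ` E \<subseteq> {..<Suc n}"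
    using idx(1) by auto
  have admissible_0: "admissible {0} = matchings E ends"
    and admissible_empty: "admissible {} = perfect_matchings V E ends"
    using vs(1) by (simp_all add: admissible_def perfect_matchings_def)
  show ?thesis
  proof (intro conjI impI)
    \<comment> \<open>The dimension is one more than the number of edges, because it must be positive even if
      there are none.\<close>
    assume size: "2 \<le> card V + 2 * card E"
    have "2 \<le> length vs"
      using size len two_le_length by (cases "E = {}") auto
    then have "block_configuration (Suc n) (blocks {0})"
      by (intro block_configuration_blocks idx_less) auto
    moreover have "config_size (blocks {0}) = card V + 2 * card E"
      by (simp add: config_size_blocks len)
    moreover have "affinely_isomorphic (CTP (blocks {0})) (matching_polytope E ends)"
      using CTP_affinely_isomorphic [of "{0}"] by (simp add: admissible_0 matching_polytope_def)
    ultimately show "\<exists>d \<B>. block_configuration d \<B> \<and> config_size \<B> = card V + 2 * card E \<and>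
        affinely_isomorphic (CTP \<B>) (matching_polytope E ends)"
      by blast
  next
    assume size: "2 \<le> 2 * card E"
    show "\<exists>d \<B>. block_configuration d \<B> \<and> config_size \<B> = 2 * card E \<and>
        affinely_isomorphic (CTP \<B>) (perfect_matching_polytope V E ends)"
    proof (cases "\<forall>i<length vs. star i \<noteq> {}")
      case True
      have "E \<noteq> {}"
        using size by auto
      then have "2 \<le> length vs"
        by (rule two_le_length)
      then have "block_configuration (Suc n) (blocks {})"
        using True by (intro block_configuration_blocks idx_less) auto
      moreover have "config_size (blocks {}) = 2 * card E"
        by (simp add: config_size_blocks)
      moreover have "affinely_isomorphic (CTP (blocks {})) (perfect_matching_polytope V E ends)"
        using CTP_affinely_isomorphic [of "{}"]
        by (simp add: admissible_empty perfect_matching_polytope_def)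
      ultimately show ?thesis
        by blast
    next
      case False
      then obtain i where i: "i < length vs" "star i = {}"
        by blast
      then have "vs ! i \<in> V" and isolated: "\<And>e. e \<in> E \<Longrightarrow> vs ! i \<notin> ends e"
        using vs(1) by (auto simp: star_def)
      have "perfect_matchings V E ends = {}"
      proof (rule equals0I)
        fix M assume "M \<in> perfect_matchings V E ends"
        then have "M \<subseteq> E" "vs ! i \<in> (\<Union>e\<in>M. ends e)"
          using \<open>vs ! i \<in> V\<close> by (auto simp: perfect_matchings_def matchings_def)
        then show False
          using isolated by blast
      qed
      moreover obtain d \<B> where \<B>: "block_configuration d \<B>" "config_size \<B> = 2 * card E"
          "cyclic_transversals \<B> = {}"
        using ex_block_configuration_no_transversal [OF size] by blast
      ultimately have "CTP \<B> = {}" "perfect_matching_polytope V E ends = {}"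
        by (simp_all add: CTP_def perfect_matching_polytope_def)
      then have "affinely_isomorphic (CTP \<B>) (perfect_matching_polytope V E ends)"
        using linear_zero by (auto simp: affinely_isomorphic_def bij_betw_def)
      with \<B> show ?thesis
        by blast
    qed
  qed
qed

end
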